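(* Let $\mathsf{MLJL}$ be a modal-justification logic, and $\mathsf{CS}$ a constant specification for $\mathsf{MLJL}$, with the requirement that if $\mathsf{JL}$ includes axiom scheme (jD) then $\mathsf{CS}$ is axiomatically appropriate. Then $\mathsf{MLJL}_{\mathsf{CS}}$ is sound and complete with respect to $\mathsf{MLJL}_{\mathsf{CS}}$-models: a formula of $\mathsf{MLJL}$ is a theorem of $\mathsf{MLJL}_{\mathsf{CS}}$ if and only if it is true in every $\mathsf{MLJL}_{\mathsf{CS}}$-model.
   Context: Modal logics. Modal formulas are built from propositional variables and $\bot$ by $\neg,\wedge,\vee,\to,\Box$. $\mathsf K$ has all propositional tautologies and $\Box(A\to B)\to(\Box A\to\Box B)$, with Modus Ponens and Necessitation. Schemes: (T) $\Box A\to A$; (D) $\Box\bot\to\bot$; (4) $\Box A\to\Box\Box A$; (B) $\neg A\to\Box\neg\Box A$; (5) $\neg\Box A\to\Box\neg\Box A$. $\mathsf{ML}$ ranges over $\mathsf{K},\mathsf{T},\mathsf{D},\mathsf{K4},\mathsf{KB},\mathsf{K5},\mathsf{KB5},\mathsf{K45},\mathsf{D5},\mathsf{DB},\mathsf{D4},\mathsf{D45},\mathsf{TB},\mathsf{S4}=\mathsf{KT4},\mathsf{S5}=\mathsf{KT45}$, the name listing the schemes added to $\mathsf K$. Justification logics. Terms are built from justification variables and constants by binary $\cdot,+$ and (depending on the logic) unary $!$, $?$, $\bar{?}$. Justification formulas are built from propositional variables and $\bot$ by $\neg,\wedge,\vee,\to$ and $t:A$. $\mathsf J$ has axiom schemes: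 propositional tautologies; $s:A\to(s+t):A$, $s:A\to(t+s):A$; $s:(A\to B)\to(t:A\to(s\cdot t):B)$. A justification logic $\mathsf{JL}$ is $\mathsf J$ extended by at most one of (jT) $t:A\to A$, (jD) $t:\bot\to\bot$, and by any subset of (j4) $t:A\to\,!t:t:A$, (jB) $\neg A\to\bar{?}t:\neg t:A$, (j5) $\neg t:A\to\,?t:\neg t:A$; its language contains $!$ (resp. $\bar{?}$, $?$) exactly when (j4) (resp. (jB), (j5)) is an axiom. Rules: Modus Ponens and: if (j4) is an axiom, infer $c:A$ for every axiom instance $A$ and constant $c$; otherwise infer $c_n:\dots:c_1:A$ for every axiom instance $A$, constants $c_j$, $n\ge1$. For a justification formula $F$, $F^\circ$ is the modal formula obtained by replacing each $t:B$ by $\Box B$; $\mathsf{JL}^\circ=\{F^\circ\mid\mathsf{JL}\vdash F\}$. Modal-justification logics. If $\mathsf{JL}^\circ=\mathsf{ML}$ (as sets of theorems), $\mathsf{MLJL}$ is the logic whose formulas are built from propositional variables and $\bot$ by $\neg,\wedge,\vee,\to$, $t:A$ ($t$ a term of $\mathsf{JL}$) and $\Box A$, whose axioms and rules are those of $\mathsf{ML}$ and $\mathsf{JL}$ (schemes read over this combined language) plus $t:A\to\Box A$. A constant specification $\mathsf{CS}$ for $\mathsf{MLJL}$: if (j4) is not an axiom, a set of formulas $c_n:\dots:c_1:A$ ($n\ge1$, $c_j$ constants, $A$ an axiom instance of $\mathsf{MLJL}$), closed under passing from $c_n:c_{n-1}:\dots:c_1:A$ to $c_{n-1}:\dots:c_1:A$;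 if (j4) is an axiom, a set of formulas $c:A$ with $c$ a constant and $A$ an axiom instance. It is axiomatically appropriate if for each axiom instance $A$ some $c:A\in\mathsf{CS}$ and, when (j4) is not an axiom, for each $F\in\mathsf{CS}$ some $c:F\in\mathsf{CS}$. $\mathsf{MLJL}_{\mathsf{CS}}$ has the axioms of $\mathsf{MLJL}$, Modus Ponens, Necessitation, and the rule inferring members of $\mathsf{CS}$ (in place of the rules introducing arbitrary constants). Models. An $\mathsf{MLJL}_{\mathsf{CS}}$-model is $\mathcal M=(\mathcal W,\mathcal R,\mathcal E,\mathcal V)$ with $\mathcal W\neq\emptyset$, $\mathcal R\subseteq\mathcal W\times\mathcal W$, $\mathcal V$ a map from propositional variables to subsets of $\mathcal W$, and $\mathcal E$ a map from pairs (term of $\mathsf{JL}$, formula of $\mathsf{MLJL}$) to subsets of $\mathcal W$ with $\mathcal E(c,F)=\mathcal W$ for each $c:F\in\mathsf{CS}$. Forcing: $(\mathcal M,w)\Vdash P$ iff $w\in\mathcal V(P)$; Boolean connectives are classical; $(\mathcal M,w)\Vdash t:F$ iff $w\in\mathcal E(t,F)$ and $(\mathcal M,v)\Vdash F$ for all $v$ with $w\mathcal Rv$; $(\mathcal M,w)\Vdash\Box A$ iff $(\mathcal M,v)\Vdash A$ for all $v$ with $w\mathcal Rv$. Conditions: $\mathcal E(s,A\to B)\cap\mathcal E(t,A)\subseteq\mathcal E(s\cdot t,B)$; $\mathcal E(s,A)\cup\mathcal E(t,A)\subseteq\mathcal E(s+t,A)$; if (jT) is an axiom, $\mathcal R$ is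 reflexive; if (jD), $\mathcal R$ is serial; if (j4), $\mathcal R$ is transitive, $w\in\mathcal E(t,A)$ and $w\mathcal Rv$ imply $v\in\mathcal E(t,A)$, and $\mathcal E(t,A)\subseteq\mathcal E(!t,t:A)$; if (jB), $\mathcal R$ is symmetric and $(\mathcal M,w)\Vdash\neg A$ implies $w\in\mathcal E(\bar{?}t,\neg t:A)$ for all $t$; if (j5), $\mathcal W\setminus\mathcal E(t,A)\subseteq\mathcal E(?t,\neg t:A)$, and $w\in\mathcal E(t,A)$ implies $(\mathcal M,w)\Vdash t:A$; if the modal scheme (5) is an axiom, $\mathcal R$ is Euclidean. A formula is true in $\mathcal M$ if it is forced at every world. *)

theory Defs
  imports Main
begin

section \<open>Syntax\<close>

text \<open>
  A logic is given by the set of schemes it adds to \<open>K\<close> (modal side) or to \<open>J\<close>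
  (justification side).
\<close>

datatype mscheme = mT | mD | m4 | mB | m5

datatype jscheme = jT | jD | j4 | jB | j5

text \<open>
  One term type and one formula type carry all operations. The languages of the individual
  logics are the subsets \<open>modal_lang\<close>, \<open>just_lang\<close> and \<open>mj_lang\<close> below. The type
  variables stand for the justification variables, the constants and the
  propositional variables.
\<close>

datatype ('v, 'c) jterm =
    JVar 'v
  | JConst 'c
  | App "('v, 'c) jterm" "('v, 'c) jterm"
  | Plus "('v, 'c) jterm" "('v, 'c) jterm"
  | Bang "('v, 'c) jterm"
  | Query "('v, 'c) jterm"
  | BQuery "('v, 'c) jterm"  \<comment> \<open>the operation written as a barred question mark, belonging to (jB)\<close>

datatype ('v, 'c, 'p) fml =
    Prop 'p
  | Bot
  | Neg "('v, 'c, 'p) fml"  ("\<^bold>\<not> _" [70] 70)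
  | And "('v, 'c, 'p) fml" "('v, 'c, 'p) fml"  (infixr "\<^bold>\<and>" 65)
  | Or "('v, 'c, 'p) fml" "('v, 'c, 'p) fml"  (infixr "\<^bold>\<or>" 60)
  | Imp "('v, 'c, 'p) fml" "('v, 'c, 'p) fml"  (infixr "\<^bold>\<rightarrow>" 55)
  | Just "('v, 'c) jterm" "('v, 'c, 'p) fml"  ("_ \<^bold>: _" [71, 70] 70)
  | Box "('v, 'c, 'p) fml"  ("\<^bold>\<box> _" [70] 70)

primrec term_of :: "jscheme set \<Rightarrow> ('v, 'c) jterm \<Rightarrow> bool" where
  "term_of js (JVar x) \<longleftrightarrow> True"
| "term_of js (JConst c) \<longleftrightarrow> True"
| "term_of js (App s t) \<longleftrightarrow> term_of js s \<and> term_of js t"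
| "term_of js (Plus s t) \<longleftrightarrow> term_of js s \<and> term_of js t"
| "term_of js (Bang t) \<longleftrightarrow> j4 \<in> js \<and> term_of js t"
| "term_of js (Query t) \<longleftrightarrow> j5 \<in> js \<and> term_of js t"
| "term_of js (BQuery t) \<longleftrightarrow> jB \<in> js \<and> term_of js t"

primrec terms_ok :: "jscheme set \<Rightarrow> ('v, 'c, 'p) fml \<Rightarrow> bool" where
  "terms_ok js (Prop p) \<longleftrightarrow> True"
| "terms_ok js Bot \<longleftrightarrow> True"
| "terms_ok js (Neg A) \<longleftrightarrow> terms_ok js A"
| "terms_ok js (And A B) \<longleftrightarrow> terms_ok js A \<and> terms_ok js B"
| "terms_ok js (Or A B) \<longleftrightarrow> terms_ok js A \<and> terms_ok js B"
| "terms_ok js (Imp A B) \<longleftrightarrow> terms_ok js A \<and> terms_ok js B"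
| "terms_ok js (Just t A) \<longleftrightarrow> term_of js t \<and> terms_ok js A"
| "terms_ok js (Box A) \<longleftrightarrow> terms_ok js A"

primrec box_free :: "('v, 'c, 'p) fml \<Rightarrow> bool" where
  "box_free (Prop p) \<longleftrightarrow> True"
| "box_free Bot \<longleftrightarrow> True"
| "box_free (Neg A) \<longleftrightarrow> box_free A"
| "box_free (And A B) \<longleftrightarrow> box_free A \<and> box_free B"
| "box_free (Or A B) \<longleftrightarrow> box_free A \<and> box_free B"
| "box_free (Imp A B) \<longleftrightarrow> box_free A \<and> box_free B"
| "box_free (Just t A) \<longleftrightarrow> box_free A"
| "box_free (Box A) \<longleftrightarrow> False"

primrec just_free :: "('v, 'c, 'p) fml \<Rightarrow> bool" where
  "just_free (Prop p) \<longleftrightarrow> True"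
| "just_free Bot \<longleftrightarrow> True"
| "just_free (Neg A) \<longleftrightarrow> just_free A"
| "just_free (And A B) \<longleftrightarrow> just_free A \<and> just_free B"
| "just_free (Or A B) \<longleftrightarrow> just_free A \<and> just_free B"
| "just_free (Imp A B) \<longleftrightarrow> just_free A \<and> just_free B"
| "just_free (Just t A) \<longleftrightarrow> False"
| "just_free (Box A) \<longleftrightarrow> just_free A"

definition modal_lang :: "('v, 'c, 'p) fml set" where
  "modal_lang = {A. just_free A}"

definition just_lang :: "jscheme set \<Rightarrow> ('v, 'c, 'p) fml set" where
  "just_lang js = {A. terms_ok js A \<and> box_free A}"

definition mj_lang :: "jscheme set \<Rightarrow> ('v, 'c, 'p) fml set" where
  "mj_lang js = {A. terms_ok js A}"


section \<open>Axiom schemes\<close>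

text \<open>
  Boolean evaluation in which propositional variables and all formulas of the forms \<open>t : A\<close>
  and \<open>\<box> A\<close> are atoms with arbitrary truth values.
\<close>

primrec bool_eval :: "(('v, 'c, 'p) fml \<Rightarrow> bool) \<Rightarrow> ('v, 'c, 'p) fml \<Rightarrow> bool" where
  "bool_eval e (Prop p) \<longleftrightarrow> e (Prop p)"
| "bool_eval e Bot \<longleftrightarrow> False"
| "bool_eval e (Neg A) \<longleftrightarrow> \<not> bool_eval e A"
| "bool_eval e (And A B) \<longleftrightarrow> bool_eval e A \<and> bool_eval e B"
| "bool_eval e (Or A B) \<longleftrightarrow> bool_eval e A \<or> bool_eval e B"
| "bool_eval e (Imp A B) \<longleftrightarrow> (bool_eval e A \<longrightarrow> bool_eval e B)"
| "bool_eval e (Just t A) \<longleftrightarrow> e (Just t A)"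
| "bool_eval e (Box A) \<longleftrightarrow> e (Box A)"

definition tautology :: "('v, 'c, 'p) fml \<Rightarrow> bool" where
  "tautology A \<longleftrightarrow> (\<forall>e. bool_eval e A)"

text \<open>
  Instances of the schemes are described without reference to a language. Intersecting with a
  language (closed under subformulas and subterms) gives the scheme read over that language.
\<close>

inductive modal_inst :: "mscheme set \<Rightarrow> ('v, 'c, 'p) fml \<Rightarrow> bool" for ms where
  m_taut: "tautology A \<Longrightarrow> modal_inst ms A"
| m_K: "modal_inst ms (\<^bold>\<box> (A \<^bold>\<rightarrow> B) \<^bold>\<rightarrow> (\<^bold>\<box> A \<^bold>\<rightarrow> \<^bold>\<box> B))"
| m_T: "mT \<in> ms \<Longrightarrow> modal_inst ms (\<^bold>\<box> A \<^bold>\<rightarrow> A)"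
| m_D: "mD \<in> ms \<Longrightarrow> modal_inst ms (\<^bold>\<box> Bot \<^bold>\<rightarrow> Bot)"
| m_4: "m4 \<in> ms \<Longrightarrow> modal_inst ms (\<^bold>\<box> A \<^bold>\<rightarrow> \<^bold>\<box> \<^bold>\<box> A)"
| m_B: "mB \<in> ms \<Longrightarrow> modal_inst ms (\<^bold>\<not> A \<^bold>\<rightarrow> \<^bold>\<box> \<^bold>\<not> \<^bold>\<box> A)"
| m_5: "m5 \<in> ms \<Longrightarrow> modal_inst ms (\<^bold>\<not> \<^bold>\<box> A \<^bold>\<rightarrow> \<^bold>\<box> \<^bold>\<not> \<^bold>\<box> A)"

inductive just_inst :: "jscheme set \<Rightarrow> ('v, 'c, 'p) fml \<Rightarrow> bool" for js where
  j_taut: "tautology A \<Longrightarrow> just_inst js A"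
| j_sum1: "just_inst js (s \<^bold>: A \<^bold>\<rightarrow> (Plus s t) \<^bold>: A)"
| j_sum2: "just_inst js (s \<^bold>: A \<^bold>\<rightarrow> (Plus t s) \<^bold>: A)"
| j_app: "just_inst js (s \<^bold>: (A \<^bold>\<rightarrow> B) \<^bold>\<rightarrow> (t \<^bold>: A \<^bold>\<rightarrow> (App s t) \<^bold>: B))"
| j_T: "jT \<in> js \<Longrightarrow> just_inst js (t \<^bold>: A \<^bold>\<rightarrow> A)"
| j_D: "jD \<in> js \<Longrightarrow> just_inst js (t \<^bold>: Bot \<^bold>\<rightarrow> Bot)"
| j_4: "j4 \<in> js \<Longrightarrow> just_inst js (t \<^bold>: A \<^bold>\<rightarrow> (Bang t) \<^bold>: t \<^bold>: A)"
| j_B: "jB \<in> js \<Longrightarrow> just_inst js (\<^bold>\<not> A \<^bold>\<rightarrow> (BQuery t) \<^bold>: \<^bold>\<not> t \<^bold>: A)"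
| j_5: "j5 \<in> js \<Longrightarrow> just_inst js (\<^bold>\<not> t \<^bold>: A \<^bold>\<rightarrow> (Query t) \<^bold>: \<^bold>\<not> t \<^bold>: A)"

inductive connection_inst :: "('v, 'c, 'p) fml \<Rightarrow> bool" where
  "connection_inst (t \<^bold>: A \<^bold>\<rightarrow> \<^bold>\<box> A)"

definition modal_axioms :: "mscheme set \<Rightarrow> ('v, 'c, 'p) fml set" where
  "modal_axioms ms = {A \<in> modal_lang. modal_inst ms A}"

definition just_axioms :: "jscheme set \<Rightarrow> ('v, 'c, 'p) fml set" where
  "just_axioms js = {A \<in> just_lang js. just_inst js A}"

definition mj_axioms :: "mscheme set \<Rightarrow> jscheme set \<Rightarrow> ('v, 'c, 'p) fml set" where
  "mj_axioms ms js = {A \<in> mj_lang js. modal_inst ms A \<or> just_inst js A \<or> connection_inst A}"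


section \<open>Modal logics and justification logics\<close>

text \<open>
  In the order of the list: K, T, D, K4, KB, K5, KB5, K45, D5, DB, D4, D45, TB,
  S4 = KT4, S5 = KT45.
\<close>

definition modal_logics :: "mscheme set set" where
  "modal_logics =
    {{}, {mT}, {mD}, {m4}, {mB}, {m5}, {mB, m5}, {m4, m5}, {mD, m5}, {mD, mB}, {mD, m4},
     {mD, m4, m5}, {mT, mB}, {mT, m4}, {mT, m4, m5}}"

definition just_logics :: "jscheme set set" where
  "just_logics = {js. \<not> (jT \<in> js \<and> jD \<in> js)}"

inductive modal_thm :: "mscheme set \<Rightarrow> ('v, 'c, 'p) fml \<Rightarrow> bool" for ms where
  modal_ax: "A \<in> modal_axioms ms \<Longrightarrow> modal_thm ms A"
| modal_mp: "modal_thm ms (A \<^bold>\<rightarrow> B) \<Longrightarrow> modal_thm ms A \<Longrightarrow> modal_thm ms B"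
| modal_nec: "modal_thm ms A \<Longrightarrow> modal_thm ms (\<^bold>\<box> A)"

text \<open>\<open>const_prefix [c\<^sub>n, \<dots>, c\<^sub>1] A\<close> is the formula \<open>c\<^sub>n : \<dots> : c\<^sub>1 : A\<close>.\<close>

primrec const_prefix :: "'c list \<Rightarrow> ('v, 'c, 'p) fml \<Rightarrow> ('v, 'c, 'p) fml" where
  "const_prefix [] A = A"
| "const_prefix (c # cs) A = (JConst c) \<^bold>: const_prefix cs A"

inductive just_thm :: "jscheme set \<Rightarrow> ('v, 'c, 'p) fml \<Rightarrow> bool" for js where
  just_ax: "A \<in> just_axioms js \<Longrightarrow> just_thm js A"
| just_mp: "just_thm js (A \<^bold>\<rightarrow> B) \<Longrightarrow> just_thm js A \<Longrightarrow> just_thm js B"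
| just_const: "j4 \<in> js \<Longrightarrow> A \<in> just_axioms js \<Longrightarrow> just_thm js ((JConst c) \<^bold>: A)"
| just_iter_const: "j4 \<notin> js \<Longrightarrow> A \<in> just_axioms js \<Longrightarrow> cs \<noteq> [] \<Longrightarrow>
    just_thm js (const_prefix cs A)"

primrec forget :: "('v, 'c, 'p) fml \<Rightarrow> ('v, 'c, 'p) fml" where
  "forget (Prop p) = Prop p"
| "forget Bot = Bot"
| "forget (Neg A) = Neg (forget A)"
| "forget (And A B) = And (forget A) (forget B)"
| "forget (Or A B) = Or (forget A) (forget B)"
| "forget (Imp A B) = Imp (forget A) (forget B)"
| "forget (Just t A) = Box (forget A)"
| "forget (Box A) = Box (forget A)"  \<comment> \<open>never used: only applied to theorems of a justification logic\<close>

definition forgetful_image :: "jscheme set \<Rightarrow> ('v, 'c, 'p) fml set" where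
  "forgetful_image js = {forget F | F. just_thm js F}"


section \<open>Modal-justification logics\<close>

text \<open>
  The argument \<open>T\<close> is only a type token. It fixes the atoms over which both logics are formed.
\<close>

definition mj_logic :: "('v, 'c, 'p) fml itself \<Rightarrow> mscheme set \<Rightarrow> jscheme set \<Rightarrow> bool" where
  "mj_logic T ms js \<longleftrightarrow>
    ms \<in> modal_logics \<and> js \<in> just_logics \<and>
    (forgetful_image js :: ('v, 'c, 'p) fml set) = {A. modal_thm ms A}"

definition constant_spec ::
    "mscheme set \<Rightarrow> jscheme set \<Rightarrow> ('v, 'c, 'p) fml set \<Rightarrow> bool" where
  "constant_spec ms js CS \<longleftrightarrow>
    (if j4 \<in> js then
       (\<forall>G \<in> CS. \<exists>c A. A \<in> mj_axioms ms js \<and> G = (JConst c) \<^bold>: A)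
     else
       (\<forall>G \<in> CS. \<exists>cs A. cs \<noteq> [] \<and> A \<in> mj_axioms ms js \<and> G = const_prefix cs A) \<and>
       (\<forall>c cs A. cs \<noteq> [] \<longrightarrow> A \<in> mj_axioms ms js \<longrightarrow>
          const_prefix (c # cs) A \<in> CS \<longrightarrow> const_prefix cs A \<in> CS))"

definition axiomatically_appropriate ::
    "mscheme set \<Rightarrow> jscheme set \<Rightarrow> ('v, 'c, 'p) fml set \<Rightarrow> bool" where
  "axiomatically_appropriate ms js CS \<longleftrightarrow>
    (\<forall>A \<in> mj_axioms ms js. \<exists>c. (JConst c) \<^bold>: A \<in> CS) \<and>
    (j4 \<notin> js \<longrightarrow> (\<forall>F \<in> CS. \<exists>c. (JConst c) \<^bold>: F \<in> CS))"

inductive mj_thm ::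
    "mscheme set \<Rightarrow> jscheme set \<Rightarrow> ('v, 'c, 'p) fml set \<Rightarrow> ('v, 'c, 'p) fml \<Rightarrow> bool"
  for ms js CS where
  mj_ax: "A \<in> mj_axioms ms js \<Longrightarrow> mj_thm ms js CS A"
| mj_mp: "mj_thm ms js CS (A \<^bold>\<rightarrow> B) \<Longrightarrow> mj_thm ms js CS A \<Longrightarrow> mj_thm ms js CS B"
| mj_nec: "mj_thm ms js CS A \<Longrightarrow> mj_thm ms js CS (\<^bold>\<box> A)"
| mj_const: "F \<in> CS \<Longrightarrow> mj_thm ms js CS F"


section \<open>Models\<close>

record ('w, 'v, 'c, 'p) mj_model =
  worlds :: "'w set"
  acc :: "('w \<times> 'w) set"
  evid :: "('v, 'c) jterm \<Rightarrow> ('v, 'c, 'p) fml \<Rightarrow> 'w set"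
  val :: "'p \<Rightarrow> 'w set"

primrec forces :: "('w, 'v, 'c, 'p) mj_model \<Rightarrow> 'w \<Rightarrow> ('v, 'c, 'p) fml \<Rightarrow> bool" where
  "forces M w (Prop p) \<longleftrightarrow> w \<in> val M p"
| "forces M w Bot \<longleftrightarrow> False"
| "forces M w (Neg A) \<longleftrightarrow> \<not> forces M w A"
| "forces M w (And A B) \<longleftrightarrow> forces M w A \<and> forces M w B"
| "forces M w (Or A B) \<longleftrightarrow> forces M w A \<or> forces M w B"
| "forces M w (Imp A B) \<longleftrightarrow> (forces M w A \<longrightarrow> forces M w B)"
| "forces M w (Just t A) \<longleftrightarrow> w \<in> evid M t A \<and> (\<forall>v. (w, v) \<in> acc M \<longrightarrow> forces M v A)"
| "forces M w (Box A) \<longleftrightarrow> (\<forall>v. (w, v) \<in> acc M \<longrightarrow> forces M v A)"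

text \<open>
  The evidence map is a total function on the types, so it also has values on terms and
  formulas outside the language of the logic. These are unconstrained, and they do not affect
  forcing of formulas of the language.
\<close>

definition is_mj_model ::
    "mscheme set \<Rightarrow> jscheme set \<Rightarrow> ('v, 'c, 'p) fml set \<Rightarrow> ('w, 'v, 'c, 'p) mj_model \<Rightarrow> bool"
  where
  "is_mj_model ms js CS M \<longleftrightarrow>
    worlds M \<noteq> {} \<and>
    acc M \<subseteq> worlds M \<times> worlds M \<and>
    (\<forall>p. val M p \<subseteq> worlds M) \<and>
    (\<forall>t A. term_of js t \<longrightarrow> A \<in> mj_lang js \<longrightarrow> evid M t A \<subseteq> worlds M) \<and>
    (\<forall>c F. (JConst c) \<^bold>: F \<in> CS \<longrightarrow> evid M (JConst c) F = worlds M) \<and>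
    (\<forall>s t A B. term_of js s \<longrightarrow> term_of js t \<longrightarrow> A \<in> mj_lang js \<longrightarrow> B \<in> mj_lang js \<longrightarrow>
       evid M s (A \<^bold>\<rightarrow> B) \<inter> evid M t A \<subseteq> evid M (App s t) B) \<and>
    (\<forall>s t A. term_of js s \<longrightarrow> term_of js t \<longrightarrow> A \<in> mj_lang js \<longrightarrow>
       evid M s A \<union> evid M t A \<subseteq> evid M (Plus s t) A) \<and>
    (jT \<in> js \<longrightarrow> refl_on (worlds M) (acc M)) \<and>
    (jD \<in> js \<longrightarrow> (\<forall>w \<in> worlds M. \<exists>v. (w, v) \<in> acc M)) \<and>
    (j4 \<in> js \<longrightarrow>
       trans (acc M) \<and>
       (\<forall>t A w v. term_of js t \<longrightarrow> A \<in> mj_lang js \<longrightarrow>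
          w \<in> evid M t A \<longrightarrow> (w, v) \<in> acc M \<longrightarrow> v \<in> evid M t A) \<and>
       (\<forall>t A. term_of js t \<longrightarrow> A \<in> mj_lang js \<longrightarrow>
          evid M t A \<subseteq> evid M (Bang t) (t \<^bold>: A))) \<and>
    (jB \<in> js \<longrightarrow>
       sym (acc M) \<and>
       (\<forall>t A. \<forall>w \<in> worlds M. term_of js t \<longrightarrow> A \<in> mj_lang js \<longrightarrow>
          forces M w (\<^bold>\<not> A) \<longrightarrow> w \<in> evid M (BQuery t) (\<^bold>\<not> t \<^bold>: A))) \<and>
    (j5 \<in> js \<longrightarrow>
       (\<forall>t A. term_of js t \<longrightarrow> A \<in> mj_lang js \<longrightarrow>
          worlds M - evid M t A \<subseteq> evid M (Query t) (\<^bold>\<not> t \<^bold>: A)) \<and>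
       (\<forall>t A w. term_of js t \<longrightarrow> A \<in> mj_lang js \<longrightarrow>
          w \<in> evid M t A \<longrightarrow> forces M w (t \<^bold>: A))) \<and>
    (m5 \<in> ms \<longrightarrow> (\<forall>u v w. (u, v) \<in> acc M \<longrightarrow> (u, w) \<in> acc M \<longrightarrow> (v, w) \<in> acc M))"

definition true_in :: "('w, 'v, 'c, 'p) mj_model \<Rightarrow> ('v, 'c, 'p) fml \<Rightarrow> bool" where
  "true_in M F \<longleftrightarrow> (\<forall>w \<in> worlds M. forces M w F)"

end

theory Submission
  imports Defs
begin

text \<open>
  Soundness is an induction on derivations, and completeness uses one canonical model whose
  worlds are the maximal consistent sets of formulas of the language, with accessibility read off
  from \<open>\<box>\<close> and evidence read off from membership of \<open>t : A\<close>. Both directions meet the same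
  obstacle: the modal axioms are governed by \<open>ms\<close>, whereas the conditions on models are, except for
  Euclideanness, governed by \<open>js\<close>. The only link between the two is that the forgetful image of
  the justification logic is the set of theorems of the modal logic.

  The link is used as follows. Forgetting maps theorems of the justification logic to theorems of
  the modal logic axiomatized by the modal counterparts of the schemes in \<open>js\<close>
  (\<open>modal_thm_forget\<close>). Hence every scheme in \<open>ms\<close> is provable from the counterparts of \<open>js\<close>, and is
  valid on every frame with the corresponding properties; this gives soundness of the modal axioms.
  Conversely, the counterpart of each scheme in \<open>js\<close> is the forgetful image of one of its
  instances, so its instance at a propositional variable is a theorem of the modal logic; by
  substitution all its instances over the combined language are theorems
  (\<open>provable_counterpart\<close>), and the canonical frame has the property required by \<open>js\<close>.

  One condition needs separate treatment: a model is required to be Euclidean when (5) is a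
  modal axiom, while the counterpart of (j5) is also (5). If (j5) is an axiom then the modal logic
  proves (5), and two small frames show that each modal logic in the list that proves (5) has it as
  an axiom (\<open>j5_imp_m5\<close>).

  The connection axiom \<open>t : A \<rightarrow> \<box> A\<close> is what makes the truth lemma work for \<open>t : A\<close>: a world
  containing \<open>t : A\<close> also contains \<open>\<box> A\<close>, so the single relation defined from \<open>\<box>\<close> serves
  both modalities.
\<close>


section \<open>Modal schemes and their frame conditions\<close>

primrec modal_scheme :: "mscheme \<Rightarrow> ('v, 'c, 'p) fml \<Rightarrow> ('v, 'c, 'p) fml" where
  "modal_scheme mT A = (\<^bold>\<box> A \<^bold>\<rightarrow> A)"
| "modal_scheme mD A = (\<^bold>\<box> Bot \<^bold>\<rightarrow> Bot)"
| "modal_scheme m4 A = (\<^bold>\<box> A \<^bold>\<rightarrow> \<^bold>\<box> \<^bold>\<box> A)"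
| "modal_scheme mB A = (\<^bold>\<not> A \<^bold>\<rightarrow> \<^bold>\<box> \<^bold>\<not> \<^bold>\<box> A)"
| "modal_scheme m5 A = (\<^bold>\<not> \<^bold>\<box> A \<^bold>\<rightarrow> \<^bold>\<box> \<^bold>\<not> \<^bold>\<box> A)"

primrec frame_cond :: "mscheme \<Rightarrow> 'w set \<Rightarrow> ('w \<times> 'w) set \<Rightarrow> bool" where
  "frame_cond mT W R \<longleftrightarrow> (\<forall>w\<in>W. (w, w) \<in> R)"
| "frame_cond mD W R \<longleftrightarrow> (\<forall>w\<in>W. \<exists>v. (w, v) \<in> R)"
| "frame_cond m4 W R \<longleftrightarrow> trans R"
| "frame_cond mB W R \<longleftrightarrow> sym R"
| "frame_cond m5 W R \<longleftrightarrow> (\<forall>u v w. (u, v) \<in> R \<longrightarrow> (u, w) \<in> R \<longrightarrow> (v, w) \<in> R)"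

primrec counterpart :: "jscheme \<Rightarrow> mscheme" where
  "counterpart jT = mT"
| "counterpart jD = mD"
| "counterpart j4 = m4"
| "counterpart jB = mB"
| "counterpart j5 = m5"

lemma modal_inst_scheme: "m \<in> ms \<Longrightarrow> modal_inst ms (modal_scheme m A)"
  by (cases m) (auto intro: modal_inst.intros)

lemma modal_instE:
  assumes "modal_inst ms A"
  obtains (tautology) "tautology A"
  | (K) B C where "A = (\<^bold>\<box> (B \<^bold>\<rightarrow> C) \<^bold>\<rightarrow> (\<^bold>\<box> B \<^bold>\<rightarrow> \<^bold>\<box> C))"
  | (scheme) m B where "m \<in> ms" "A = modal_scheme m B"
  using assms
proof cases
  case (m_T B)
  then show ?thesis using scheme[of mT B] by simp
next
  case m_D
  then show ?thesis using scheme[of mD A] by simp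
next
  case (m_4 B)
  then show ?thesis using scheme[of m4 B] by simp
next
  case (m_B B)
  then show ?thesis using scheme[of mB B] by simp
next
  case (m_5 B)
  then show ?thesis using scheme[of m5 B] by simp
qed (use tautology K in auto)

lemma forces_eq_bool_eval: "forces M w A \<longleftrightarrow> bool_eval (forces M w) A"
  by (induction A) auto

lemma forces_tautology: "tautology A \<Longrightarrow> forces M w A"
  by (subst forces_eq_bool_eval) (simp add: tautology_def)

lemma forces_modal_scheme:
  assumes "frame_cond m (worlds M) (acc M)" "w \<in> worlds M"
  shows "forces M w (modal_scheme m A)"
proof (cases m)
  case m4
  then have "trans (acc M)" using assms(1) by simp
  then show ?thesis using m4 by (auto dest: transD)
next
  case mB
  then have "sym (acc M)" using assms(1) by simp
  then show ?thesis using mB by (auto dest: symD)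
next
  case m5
  then have euclid: "\<forall>u v w. (u, v) \<in> acc M \<longrightarrow> (u, w) \<in> acc M \<longrightarrow> (v, w) \<in> acc M"
    using assms(1) by (simp only: frame_cond.simps)
  show ?thesis
    unfolding m5 modal_scheme.simps forces.simps using euclid by blast
qed (use assms in auto)

lemma modal_thm_sound:
  assumes "modal_thm ms A"
    and "acc M \<subseteq> worlds M \<times> worlds M"
    and "\<And>m. m \<in> ms \<Longrightarrow> frame_cond m (worlds M) (acc M)"
    and "w \<in> worlds M"
  shows "forces M w A"
  using assms(1,4)
proof (induction arbitrary: w rule: modal_thm.induct)
  case (modal_ax A)
  then have "modal_inst ms A"
    by (simp add: modal_axioms_def)
  then show ?case
    using modal_ax.prems assms(3) by (cases rule: modal_instE) (auto simp: forces_tautology forces_modal_scheme)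
next
  case (modal_mp A B)
  then show ?case by simp
next
  case (modal_nec A)
  have "v \<in> worlds M" if "(w, v) \<in> acc M" for v
    using that assms(2) by blast
  then show ?case using modal_nec.IH by simp
qed


section \<open>Substitution for propositional variables\<close>

primrec subst :: "('p \<Rightarrow> ('v, 'c, 'p) fml) \<Rightarrow> ('v, 'c, 'p) fml \<Rightarrow> ('v, 'c, 'p) fml" where
  "subst \<sigma> (Prop p) = \<sigma> p"
| "subst \<sigma> Bot = Bot"
| "subst \<sigma> (Neg A) = Neg (subst \<sigma> A)"
| "subst \<sigma> (And A B) = And (subst \<sigma> A) (subst \<sigma> B)"
| "subst \<sigma> (Or A B) = Or (subst \<sigma> A) (subst \<sigma> B)"
| "subst \<sigma> (Imp A B) = Imp (subst \<sigma> A) (subst \<sigma> B)"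
| "subst \<sigma> (Just t A) = Just t (subst \<sigma> A)"
| "subst \<sigma> (Box A) = Box (subst \<sigma> A)"

lemma subst_modal_scheme: "subst \<sigma> (modal_scheme m A) = modal_scheme m (subst \<sigma> A)"
  by (cases m) auto

lemma bool_eval_subst: "bool_eval e (subst \<sigma> A) \<longleftrightarrow> bool_eval (\<lambda>B. bool_eval e (subst \<sigma> B)) A"
  by (induction A) auto

lemma tautology_subst: "tautology A \<Longrightarrow> tautology (subst \<sigma> A)"
  by (simp add: tautology_def bool_eval_subst[of _ \<sigma> A])

lemma terms_ok_subst: "just_free A \<Longrightarrow> (\<And>p. terms_ok js (\<sigma> p)) \<Longrightarrow> terms_ok js (subst \<sigma> A)"
  by (induction A) auto

text \<open>
  Restricted to formulas without \<open>t : A\<close>, because the evidence map is not stable under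
  substitution.
\<close>

lemma forces_subst:
  "just_free A \<Longrightarrow> forces M w (subst \<sigma> A) \<longleftrightarrow> forces (M\<lparr>val := \<lambda>p. {v. forces M v (\<sigma> p)}\<rparr>) w A"
  by (induction A arbitrary: w) auto

lemma just_free_modal_scheme: "just_free (modal_scheme m (Prop p))"
  by (cases m) auto

text \<open>
  If a modal logic proves a scheme at a single propositional variable, then the scheme is valid
  for arbitrary formulas, even in a model with evidence, as long as the frame suits the logic:
  the variable can be interpreted by the truth set of the formula.
\<close>

lemma forces_provable_scheme:
  assumes "modal_thm ms (modal_scheme m (Prop p) :: ('v, 'c, 'p) fml)"
    and "acc M \<subseteq> worlds M \<times> worlds M"
    and "\<And>m. m \<in> ms \<Longrightarrow> frame_cond m (worlds M) (acc M)"
    and "w \<in> worlds M"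
  shows "forces M w (modal_scheme m (A :: ('v, 'c, 'p) fml))"
proof -
  let ?N = "M\<lparr>val := \<lambda>_. {v. forces M v A}\<rparr>"
  have "forces ?N w (modal_scheme m (Prop p))"
    using assms by (intro modal_thm_sound[OF assms(1)]) auto
  then have "forces M w (subst (\<lambda>_. A) (modal_scheme m (Prop p)))"
    by (simp add: forces_subst just_free_modal_scheme)
  then show ?thesis
    by (simp add: subst_modal_scheme)
qed


section \<open>The link between the modal and the justification logic\<close>

lemma bool_eval_forget: "bool_eval e (forget A) \<longleftrightarrow> bool_eval (\<lambda>B. bool_eval e (forget B)) A"
  by (induction A) auto

lemma tautology_forget: "tautology A \<Longrightarrow> tautology (forget A)"
  by (simp add: tautology_def bool_eval_forget[of _ A])

lemma just_free_forget: "just_free (forget A)"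
  by (induction A) auto

lemma modal_inst_counterpart:
  "x \<in> js \<Longrightarrow> modal_inst (counterpart ` js) (modal_scheme (counterpart x) A)"
  by (rule modal_inst_scheme) (rule imageI)

lemma modal_inst_forget: "just_inst js A \<Longrightarrow> modal_inst (counterpart ` js) (forget A)"
proof (induction rule: just_inst.induct)
  case (j_taut A)
  then show ?case by (simp add: m_taut tautology_forget)
next
  case (j_sum1 s A t)
  show ?case by (simp add: m_taut tautology_def)
next
  case (j_sum2 s A t)
  show ?case by (simp add: m_taut tautology_def)
next
  case (j_app s A B t)
  show ?case by (simp add: m_K)
next
  case (j_T t A)
  then show ?case using modal_inst_counterpart[of jT js "forget A"] by simp
next
  case (j_D t)
  then show ?case using modal_inst_counterpart[of jD js "Bot"] by simp
next
  case (j_4 t A)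
  then show ?case using modal_inst_counterpart[of j4 js "forget A"] by simp
next
  case (j_B A t)
  then show ?case using modal_inst_counterpart[of jB js "forget A"] by simp
next
  case (j_5 t A)
  then show ?case using modal_inst_counterpart[of j5 js "forget A"] by simp
qed

lemma modal_thm_forget: "just_thm js F \<Longrightarrow> modal_thm (counterpart ` js) (forget F)"
proof (induction rule: just_thm.induct)
  have ax: "modal_thm (counterpart ` js) (forget A)" if "A \<in> just_axioms js" for A
    using that by (auto simp: just_axioms_def modal_axioms_def modal_lang_def just_free_forget
        modal_inst_forget intro: modal_ax)
  {
    case (just_ax A)
    then show ?case by (rule ax)
  next
    case (just_mp A B)
    then show ?case by (auto intro: modal_mp)
  next
    case (just_const A c)
    then show ?case by (auto intro: modal_nec ax)
  next
    case (just_iter_const A cs)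
    have "modal_thm (counterpart ` js) (forget (const_prefix cs A))"
      using ax[OF just_iter_const(2)] by (induction cs) (auto intro: modal_nec)
    then show ?case .
  }
qed

lemma mj_logic_scheme_from_counterparts:
  assumes "mj_logic TYPE(('v, 'c, 'p) fml) ms js" "m \<in> ms"
  shows "modal_thm (counterpart ` js) (modal_scheme m (Prop p) :: ('v, 'c, 'p) fml)"
proof -
  have "modal_thm ms (modal_scheme m (Prop p) :: ('v, 'c, 'p) fml)"
    using assms(2) by (auto simp: modal_axioms_def modal_lang_def just_free_modal_scheme
        modal_inst_scheme intro: modal_ax)
  then have "modal_scheme m (Prop p) \<in> (forgetful_image js :: ('v, 'c, 'p) fml set)"
    using assms(1) by (simp add: mj_logic_def)
  then show ?thesis
    unfolding forgetful_image_def using modal_thm_forget by fastforce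
qed

lemma mj_logic_counterpart_provable:
  assumes "mj_logic TYPE(('v, 'c, 'p) fml) ms js" "x \<in> js"
  shows "modal_thm ms (modal_scheme (counterpart x) (Prop p) :: ('v, 'c, 'p) fml)"
proof -
  let ?t = "JVar undefined :: ('v, 'c) jterm" and ?P = "Prop p :: ('v, 'c, 'p) fml"
  have "\<exists>F \<in> just_axioms js. forget F = modal_scheme (counterpart x) ?P"
  proof (cases x)
    case jT
    then show ?thesis using assms(2)
      by (intro bexI[of _ "?t \<^bold>: ?P \<^bold>\<rightarrow> ?P"])
        (auto simp: just_axioms_def just_lang_def intro: just_inst.intros)
  next
    case jD
    then show ?thesis using assms(2)
      by (intro bexI[of _ "?t \<^bold>: Bot \<^bold>\<rightarrow> Bot"])
        (auto simp: just_axioms_def just_lang_def intro: just_inst.intros)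
  next
    case j4
    then show ?thesis using assms(2)
      by (intro bexI[of _ "?t \<^bold>: ?P \<^bold>\<rightarrow> (Bang ?t) \<^bold>: ?t \<^bold>: ?P"])
        (auto simp: just_axioms_def just_lang_def intro: just_inst.intros)
  next
    case jB
    then show ?thesis using assms(2)
      by (intro bexI[of _ "\<^bold>\<not> ?P \<^bold>\<rightarrow> (BQuery ?t) \<^bold>: \<^bold>\<not> ?t \<^bold>: ?P"])
        (auto simp: just_axioms_def just_lang_def intro: just_inst.intros)
  next
    case j5
    then show ?thesis using assms(2)
      by (intro bexI[of _ "\<^bold>\<not> ?t \<^bold>: ?P \<^bold>\<rightarrow> (Query ?t) \<^bold>: \<^bold>\<not> ?t \<^bold>: ?P"])
        (auto simp: just_axioms_def just_lang_def intro: just_inst.intros)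
  qed
  then have "modal_scheme (counterpart x) ?P \<in> forgetful_image js"
    unfolding forgetful_image_def by (metis (mono_tags, lifting) just_ax mem_Collect_eq)
  then show ?thesis
    using assms(1) by (simp add: mj_logic_def)
qed

text \<open>
  A listed logic without (5) as an axiom is sound for all reflexive symmetric frames or for all
  reflexive transitive frames, and each class contains a frame that is not Euclidean, because one of its points sees
  two points that do not see each other.
\<close>

lemma scheme_5_not_provable:
  assumes "ms \<in> modal_logics" "m5 \<notin> ms"
  shows "\<not> modal_thm ms (modal_scheme m5 (Prop p) :: ('v, 'c, 'p) fml)"
proof
  assume thm5: "modal_thm ms (modal_scheme m5 (Prop p) :: ('v, 'c, 'p) fml)"
  define M :: "(nat \<times> nat) set \<Rightarrow> (nat, 'v, 'c, 'p) mj_model" where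
    "M R = \<lparr>worlds = {0, 1, 2}, acc = R \<union> {(0, 0), (1, 1), (2, 2)}, evid = \<lambda>_ _. {}, val = \<lambda>_. {0, 1}\<rparr>" for R
  consider "ms \<subseteq> {mT, mD, mB}" | "ms \<subseteq> {mT, mD, m4}"
    using assms unfolding modal_logics_def by auto
  then show False
  proof cases
    case 1
    \<comment> \<open>World 0 sees 2, where \<open>p\<close> fails, but also 1, which sees only 0 and 1, where \<open>p\<close> holds.\<close>
    let ?M = "M {(0, 1), (1, 0), (0, 2), (2, 0)}"
    have "frame_cond m (worlds ?M) (acc ?M)" if "m \<in> ms" for m
    proof -
      have "m = mT \<or> m = mD \<or> m = mB" using that 1 by auto
      then show ?thesis by (auto simp: M_def sym_def)
    qed
    then have "forces ?M 0 (modal_scheme m5 (Prop p))"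
      by (intro modal_thm_sound[OF thm5]) (auto simp: M_def)
    then show False by (auto simp: M_def)
  next
    case 2
    \<comment> \<open>World 0 sees 2, where \<open>p\<close> fails, but also 1, which sees only itself, where \<open>p\<close> holds.\<close>
    let ?M = "M {(0, 1), (0, 2)}"
    have "frame_cond m (worlds ?M) (acc ?M)" if "m \<in> ms" for m
    proof -
      have "m = mT \<or> m = mD \<or> m = m4" using that 2 by auto
      then show ?thesis by (auto simp: M_def trans_def)
    qed
    then have "forces ?M 0 (modal_scheme m5 (Prop p))"
      by (intro modal_thm_sound[OF thm5]) (auto simp: M_def)
    then show False by (auto simp: M_def)
  qed
qed

lemma j5_imp_m5:
  assumes "mj_logic TYPE(('v, 'c, 'p) fml) ms js" "j5 \<in> js"
  shows "m5 \<in> ms"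
  using mj_logic_counterpart_provable[OF assms, of undefined] assms(1)
    scheme_5_not_provable[where 'v='v and 'c='c and 'p='p, of ms undefined]
  by (auto simp: mj_logic_def)


section \<open>Soundness\<close>

lemma is_mj_modelD:
  assumes "is_mj_model ms js CS M"
  shows is_mj_model_acc: "acc M \<subseteq> worlds M \<times> worlds M"
    and is_mj_model_CS: "\<forall>c F. (JConst c) \<^bold>: F \<in> CS \<longrightarrow> evid M (JConst c) F = worlds M"
    and is_mj_model_App:
      "\<forall>s t A B. term_of js s \<longrightarrow> term_of js t \<longrightarrow> A \<in> mj_lang js \<longrightarrow> B \<in> mj_lang js \<longrightarrow>
        evid M s (A \<^bold>\<rightarrow> B) \<inter> evid M t A \<subseteq> evid M (App s t) B"
    and is_mj_model_Plus:
      "\<forall>s t A. term_of js s \<longrightarrow> term_of js t \<longrightarrow> A \<in> mj_lang js \<longrightarrow>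
        evid M s A \<union> evid M t A \<subseteq> evid M (Plus s t) A"
    and is_mj_model_T: "jT \<in> js \<longrightarrow> refl_on (worlds M) (acc M)"
    and is_mj_model_D: "jD \<in> js \<longrightarrow> (\<forall>w \<in> worlds M. \<exists>v. (w, v) \<in> acc M)"
    and is_mj_model_4: "j4 \<in> js \<longrightarrow>
       trans (acc M) \<and>
       (\<forall>t A w v. term_of js t \<longrightarrow> A \<in> mj_lang js \<longrightarrow>
          w \<in> evid M t A \<longrightarrow> (w, v) \<in> acc M \<longrightarrow> v \<in> evid M t A) \<and>
       (\<forall>t A. term_of js t \<longrightarrow> A \<in> mj_lang js \<longrightarrow>
          evid M t A \<subseteq> evid M (Bang t) (t \<^bold>: A))"
    and is_mj_model_B: "jB \<in> js \<longrightarrow>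
       sym (acc M) \<and>
       (\<forall>t A. \<forall>w \<in> worlds M. term_of js t \<longrightarrow> A \<in> mj_lang js \<longrightarrow>
          forces M w (\<^bold>\<not> A) \<longrightarrow> w \<in> evid M (BQuery t) (\<^bold>\<not> t \<^bold>: A))"
    and is_mj_model_5: "j5 \<in> js \<longrightarrow>
       (\<forall>t A. term_of js t \<longrightarrow> A \<in> mj_lang js \<longrightarrow>
          worlds M - evid M t A \<subseteq> evid M (Query t) (\<^bold>\<not> t \<^bold>: A)) \<and>
       (\<forall>t A w. term_of js t \<longrightarrow> A \<in> mj_lang js \<longrightarrow>
          w \<in> evid M t A \<longrightarrow> forces M w (t \<^bold>: A))"
    and is_mj_model_Euclidean:
      "m5 \<in> ms \<longrightarrow> (\<forall>u v w. (u, v) \<in> acc M \<longrightarrow> (u, w) \<in> acc M \<longrightarrow> (v, w) \<in> acc M)"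
  by (insert assms[unfolded is_mj_model_def], (elim conjE, assumption)+)

lemma is_mj_model_frame_cond:
  assumes "mj_logic TYPE(('v, 'c, 'p) fml) ms js"
    and "is_mj_model ms js CS (M :: ('w, 'v, 'c, 'p) mj_model)" "m \<in> counterpart ` js"
  shows "frame_cond m (worlds M) (acc M)"
proof -
  obtain x where x: "x \<in> js" "m = counterpart x" using assms(3) by auto
  show ?thesis
  proof (cases x)
    case j5
    then have "m5 \<in> ms" using x j5_imp_m5[OF assms(1)] by simp
    then show ?thesis
      unfolding x(2) j5 counterpart.simps frame_cond.simps
      by (rule is_mj_model_Euclidean[OF assms(2), THEN mp])
  next
    case jT
    then show ?thesis
      using x is_mj_model_T[OF assms(2)] by (simp add: refl_on_def)
  next
    case jD
    then show ?thesis using x is_mj_model_D[OF assms(2)] by simp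
  next
    case j4
    then show ?thesis using x is_mj_model_4[OF assms(2)] by simp
  next
    case jB
    then show ?thesis using x is_mj_model_B[OF assms(2)] by simp
  qed
qed

lemma const_prefix_terms_ok: "terms_ok js A \<Longrightarrow> terms_ok js (const_prefix cs A)"
  by (induction cs) auto

lemma constant_specE:
  assumes "constant_spec ms js CS" "G \<in> CS"
  obtains cs A where "cs \<noteq> []" "A \<in> mj_axioms ms js" "G = const_prefix cs A"
proof (cases "j4 \<in> js")
  case True
  then obtain c A where "A \<in> mj_axioms ms js" "G = const_prefix [c] A"
    using assms by (auto simp: constant_spec_def)
  then show ?thesis using that by blast
next
  case False
  then show ?thesis using assms that by (auto simp: constant_spec_def)
qed

lemma is_mj_model_forces_just_inst:
  assumes M: "is_mj_model ms js CS M" and "just_inst js A" "terms_ok js A" and w: "w \<in> worlds M"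
  shows "forces M w A"
  using assms(2,3)
proof (induction rule: just_inst.induct)
  case (j_taut A)
  then show ?case by (simp add: forces_tautology)
next
  case (j_sum1 s A t)
  then have "evid M s A \<subseteq> evid M (Plus s t) A"
    using is_mj_model_Plus[OF M] unfolding mj_lang_def by simp
  then show ?case by auto
next
  case (j_sum2 s A t)
  then have "evid M s A \<subseteq> evid M (Plus t s) A"
    using is_mj_model_Plus[OF M] unfolding mj_lang_def by simp
  then show ?case by auto
next
  case (j_app s A B t)
  then have "evid M s (A \<^bold>\<rightarrow> B) \<inter> evid M t A \<subseteq> evid M (App s t) B"
    using is_mj_model_App[OF M] unfolding mj_lang_def by simp
  then show ?case by auto
next
  case (j_T t A)
  then have "(w, w) \<in> acc M"
    using is_mj_model_T[OF M] w unfolding refl_on_def by simp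
  then show ?case by auto
next
  case (j_D t)
  then have "\<exists>v. (w, v) \<in> acc M"
    using is_mj_model_D[OF M] w by simp
  then show ?case by auto
next
  case (j_4 t A)
  then have "trans (acc M)" "evid M t A \<subseteq> evid M (Bang t) (t \<^bold>: A)"
    "\<forall>v. w \<in> evid M t A \<longrightarrow> (w, v) \<in> acc M \<longrightarrow> v \<in> evid M t A"
    using is_mj_model_4[OF M] unfolding mj_lang_def by simp_all
  then show ?case
    unfolding forces.simps trans_def by blast
next
  case (j_B A t)
  then have "sym (acc M)" "forces M w (\<^bold>\<not> A) \<Longrightarrow> w \<in> evid M (BQuery t) (\<^bold>\<not> t \<^bold>: A)"
    using is_mj_model_B[OF M] w unfolding mj_lang_def by simp_all
  then show ?case
    unfolding forces.simps sym_def by blast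
next
  case (j_5 t A)
  \<comment> \<open>Evidence for \<open>A\<close> would force \<open>t : A\<close>, so there is none, and hence \<open>?t\<close> is evidence for
    \<open>\<not> t : A\<close>; evidence for a formula forces it at all successors.\<close>
  have strong: "\<And>t A. term_of js t \<Longrightarrow> terms_ok js A \<Longrightarrow> w \<in> evid M t A \<Longrightarrow> forces M w (t \<^bold>: A)"
    using is_mj_model_5[OF M] j_5(1) unfolding mj_lang_def mem_Collect_eq by blast
  have "worlds M - evid M t A \<subseteq> evid M (Query t) (\<^bold>\<not> t \<^bold>: A)"
    using is_mj_model_5[OF M] j_5 unfolding mj_lang_def by simp
  then have "w \<in> evid M (Query t) (\<^bold>\<not> t \<^bold>: A)" if "\<not> forces M w (t \<^bold>: A)"
    using strong[of t A] that j_5(2) w by (simp only: terms_ok.simps) blast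
  then have "forces M w ((Query t) \<^bold>: \<^bold>\<not> t \<^bold>: A)" if "\<not> forces M w (t \<^bold>: A)"
    using strong[of "Query t" "\<^bold>\<not> t \<^bold>: A"] that j_5(2) by (simp only: terms_ok.simps) blast
  then show ?case
    unfolding forces.simps(6) forces.simps(3)[of M w "t \<^bold>: A"] by blast
qed

lemma is_mj_model_forces_axiom:
  assumes logic: "mj_logic TYPE(('v, 'c, 'p) fml) ms js"
    and M: "is_mj_model ms js CS (M :: ('w, 'v, 'c, 'p) mj_model)"
    and A: "A \<in> mj_axioms ms js" and w: "w \<in> worlds M"
  shows "forces M w A"
proof -
  have acc: "acc M \<subseteq> worlds M \<times> worlds M"
    using M by (rule is_mj_model_acc)
  consider "modal_inst ms A" | "just_inst js A" "terms_ok js A" | "connection_inst A"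
    using A by (auto simp: mj_axioms_def mj_lang_def)
  then show ?thesis
  proof cases
    case 1
    then show ?thesis
    proof (cases rule: modal_instE)
      case (scheme m B)
      show ?thesis
        unfolding scheme(2)
        by (rule forces_provable_scheme[OF mj_logic_scheme_from_counterparts[OF logic scheme(1)] acc
              is_mj_model_frame_cond[OF logic M] w])
    qed (auto simp: forces_tautology)
  next
    case 2
    then show ?thesis using is_mj_model_forces_just_inst[OF M] w by blast
  next
    case 3
    then show ?thesis by cases auto
  qed
qed

lemma mj_thm_sound:
  assumes logic: "mj_logic TYPE(('v, 'c, 'p) fml) ms js"
    and CS: "constant_spec ms js CS"
    and M: "is_mj_model ms js CS (M :: ('w, 'v, 'c, 'p) mj_model)"
    and "mj_thm ms js CS F" "w \<in> worlds M"
  shows "forces M w F"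
  using assms(4,5)
proof (induction arbitrary: w rule: mj_thm.induct)
  case (mj_ax A)
  then show ?case using is_mj_model_forces_axiom[OF logic M] by blast
next
  case (mj_nec A)
  have "acc M \<subseteq> worlds M \<times> worlds M"
    using M by (rule is_mj_model_acc)
  then have "v \<in> worlds M" if "(w, v) \<in> acc M" for v
    using that by blast
  then show ?case using mj_nec.IH by simp
next
  case (mj_mp A B)
  then show ?case by simp
next
  case (mj_const F)
  have acc: "acc M \<subseteq> worlds M \<times> worlds M"
    and evid: "\<And>c F. (JConst c) \<^bold>: F \<in> CS \<Longrightarrow> evid M (JConst c) F = worlds M"
    using is_mj_model_acc[OF M] is_mj_model_CS[OF M] by blast+
  obtain cs A where cs: "cs \<noteq> []" "A \<in> mj_axioms ms js" "F = const_prefix cs A"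
    using constant_specE[OF CS mj_const(1)] .
  show ?case
  proof (cases "j4 \<in> js")
    case True
    then obtain c A where cA: "A \<in> mj_axioms ms js" "F = (JConst c) \<^bold>: A"
      using CS mj_const(1) by (auto simp: constant_spec_def)
    then show ?thesis
      using evid mj_const acc is_mj_model_forces_axiom[OF logic M cA(1)] by auto
  next
    case False
    \<comment> \<open>Forcing \<open>c : G\<close> needs \<open>G\<close> at all successors; downward closure of the specification puts \<open>G\<close>
      in it again, unless \<open>G\<close> is already an axiom.\<close>
    have down: "const_prefix cs A \<in> CS" if "cs \<noteq> []" "const_prefix (c # cs) A \<in> CS" for c cs
      using CS False that cs(2) unfolding constant_spec_def by auto
    have "const_prefix cs A \<in> CS \<Longrightarrow> cs \<noteq> [] \<Longrightarrow> w \<in> worlds M \<Longrightarrow> forces M w (const_prefix cs A)" for w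
    proof (induction cs arbitrary: w)
      case (Cons c cs)
      have "forces M v (const_prefix cs A)" if "v \<in> worlds M" for v
        using Cons.IH[OF _ _ that] down Cons.prems is_mj_model_forces_axiom[OF logic M cs(2) that]
        by (cases "cs = []") auto
      then show ?case
        using evid Cons.prems acc by auto
    qed simp
    then show ?thesis using mj_const cs by blast
  qed
qed


section \<open>Maximal consistent sets\<close>

locale mj_calculus =
  fixes ms :: "mscheme set" and js :: "jscheme set" and CS :: "('v, 'c, 'p) fml set"
  assumes CS: "constant_spec ms js CS"
begin

abbreviation provable :: "('v, 'c, 'p) fml \<Rightarrow> bool" where
  "provable \<equiv> mj_thm ms js CS"

lemma provable_axiom:
  "modal_inst ms A \<or> just_inst js A \<or> connection_inst A \<Longrightarrow> terms_ok js A \<Longrightarrow> provable A"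
  by (auto simp: mj_axioms_def mj_lang_def intro: mj_ax)

lemma provable_terms_ok: "provable A \<Longrightarrow> terms_ok js A"
proof (induction rule: mj_thm.induct)
  case (mj_const F)
  then obtain cs A where "A \<in> mj_axioms ms js" "F = const_prefix cs A"
    using constant_specE[OF CS] by blast
  then show ?case by (simp add: mj_axioms_def mj_lang_def const_prefix_terms_ok)
qed (auto simp: mj_axioms_def mj_lang_def)

text \<open>
  Derivability from hypotheses has modus ponens as its only rule, Necessitation being confined to
  theorems. This is why the deduction theorem holds.
\<close>

inductive derives :: "('v, 'c, 'p) fml set \<Rightarrow> ('v, 'c, 'p) fml \<Rightarrow> bool" for \<Gamma> where
  provable: "provable A \<Longrightarrow> derives \<Gamma> A"
| hyp: "A \<in> \<Gamma> \<Longrightarrow> terms_ok js A \<Longrightarrow> derives \<Gamma> A"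
| mp: "derives \<Gamma> (A \<^bold>\<rightarrow> B) \<Longrightarrow> derives \<Gamma> A \<Longrightarrow> derives \<Gamma> B"

lemma derives_terms_ok: "derives \<Gamma> A \<Longrightarrow> terms_ok js A"
  by (induction rule: derives.induct) (auto simp: provable_terms_ok)

lemma derives_mono: "derives \<Gamma> A \<Longrightarrow> \<Gamma> \<subseteq> \<Delta> \<Longrightarrow> derives \<Delta> A"
proof (induction rule: derives.induct)
  case (mp A B)
  then show ?case using derives.mp by blast
qed (auto intro: provable hyp)

lemma derives_empty: "derives {} A \<Longrightarrow> provable A"
proof (induction rule: derives.induct)
  case (mp A B)
  show ?case by (rule mj_mp[OF mp.IH])
qed auto

text \<open>
  All propositional reasoning below is an instance of this rule: a Boolean consequence
  of derivable formulas is derivable.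
\<close>

lemma derives_taut_conseq:
  assumes "\<forall>e. (\<forall>P\<in>set Ps. bool_eval e P) \<longrightarrow> bool_eval e C"
    and "\<forall>P\<in>set Ps. derives \<Gamma> P" and "terms_ok js C"
  shows "derives \<Gamma> C"
  using assms
proof (induction Ps arbitrary: C)
  case Nil
  then have "tautology C" by (simp add: tautology_def)
  then show ?case
    using Nil.prems(3) by (intro provable provable_axiom disjI1 m_taut)
next
  case (Cons P Ps)
  have "derives \<Gamma> (P \<^bold>\<rightarrow> C)"
  proof (rule Cons.IH)
    show "\<forall>e. (\<forall>Q\<in>set Ps. bool_eval e Q) \<longrightarrow> bool_eval e (P \<^bold>\<rightarrow> C)"
      using Cons.prems(1) by simp
    show "\<forall>Q\<in>set Ps. derives \<Gamma> Q"
      using Cons.prems(2) by simp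
    show "terms_ok js (P \<^bold>\<rightarrow> C)"
      using Cons.prems(2,3) derives_terms_ok[of \<Gamma> P] by simp
  qed
  moreover have "derives \<Gamma> P"
    using Cons.prems(2) by simp
  ultimately show ?case by (rule mp)
qed

lemma deduction:
  assumes "derives (insert A \<Gamma>) B" "terms_ok js A"
  shows "derives \<Gamma> (A \<^bold>\<rightarrow> B)"
  using assms(1)
proof (induction rule: derives.induct)
  case (provable B)
  then show ?case
    using assms(2) provable_terms_ok
    by (intro derives_taut_conseq[of "[B]"]) (auto intro: derives.provable)
next
  case (hyp B)
  show ?case
  proof (cases "B = A")
    case True
    then show ?thesis using assms(2) by (intro derives_taut_conseq[of "[]"]) auto
  next
    case False
    then show ?thesis
      using assms(2) hyp by (intro derives_taut_conseq[of "[B]"]) (auto intro: derives.hyp)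
  qed
next
  case (mp B C)
  then show ?case
    using derives_terms_ok[OF mp.IH(1)]
    by (intro derives_taut_conseq[of "[A \<^bold>\<rightarrow> (B \<^bold>\<rightarrow> C), A \<^bold>\<rightarrow> B]"]) auto
qed

lemma derives_Box: "derives \<Gamma> A \<Longrightarrow> derives (Box ` \<Gamma>) (\<^bold>\<box> A)"
proof (induction rule: derives.induct)
  case (mp A B)
  have "provable (\<^bold>\<box> (A \<^bold>\<rightarrow> B) \<^bold>\<rightarrow> (\<^bold>\<box> A \<^bold>\<rightarrow> \<^bold>\<box> B))"
    using derives_terms_ok[OF mp.hyps(1)] by (intro provable_axiom disjI1 m_K) auto
  from derives.mp[OF derives.mp[OF derives.provable[OF this] mp.IH(1)] mp.IH(2)]
  show ?case .
qed (auto intro: derives.provable derives.hyp mj_nec)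

lemma derives_chain_Union:
  assumes "derives (\<Union>\<C>) A" "subset.chain UNIV \<C>" "\<C> \<noteq> {}"
  shows "\<exists>\<Gamma>\<in>\<C>. derives \<Gamma> A"
  using assms(1)
proof (induction rule: derives.induct)
  case (provable A)
  then show ?case using assms(3) by (auto intro: derives.provable)
next
  case (hyp A)
  then show ?case by (auto intro: derives.hyp)
next
  case (mp A B)
  then obtain \<Gamma> \<Delta> where "\<Gamma> \<in> \<C>" "\<Delta> \<in> \<C>" "derives \<Gamma> (A \<^bold>\<rightarrow> B)" "derives \<Delta> A"
    by blast
  moreover have "\<Gamma> \<subseteq> \<Delta> \<or> \<Delta> \<subseteq> \<Gamma>"
    using assms(2) \<open>\<Gamma> \<in> \<C>\<close> \<open>\<Delta> \<in> \<C>\<close> by (auto simp: subset.chain_def)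
  ultimately show ?case using derives_mono derives.mp by meson
qed

definition consistent :: "('v, 'c, 'p) fml set \<Rightarrow> bool" where
  "consistent \<Gamma> \<longleftrightarrow> \<Gamma> \<subseteq> mj_lang js \<and> \<not> derives \<Gamma> Bot"

text \<open>
  Maximality in the form of negation completeness for the language of the logic.
\<close>

definition mcs :: "('v, 'c, 'p) fml set \<Rightarrow> bool" where
  "mcs \<Gamma> \<longleftrightarrow> consistent \<Gamma> \<and> (\<forall>A. terms_ok js A \<longrightarrow> A \<in> \<Gamma> \<or> (\<^bold>\<not> A) \<in> \<Gamma>)"

text \<open>
  The three parameter types need not be countable, so the extension is obtained from
  Zorn's lemma.
\<close>

lemma lindenbaum:
  assumes "consistent \<Gamma>"
  obtains \<Delta> where "mcs \<Delta>" "\<Gamma> \<subseteq> \<Delta>"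
proof -
  let ?X = "{\<Delta>. consistent \<Delta> \<and> \<Gamma> \<subseteq> \<Delta>}"
  have "\<exists>\<Delta>\<in>?X. \<forall>\<Theta>\<in>?X. \<Delta> \<subseteq> \<Theta> \<longrightarrow> \<Theta> = \<Delta>"
  proof (rule subset_Zorn)
    fix \<C> assume chain: "subset.chain ?X \<C>"
    show "\<exists>U\<in>?X. \<forall>\<Delta>\<in>\<C>. \<Delta> \<subseteq> U"
    proof (cases "\<C> = {}")
      case True
      then show ?thesis using assms by auto
    next
      case False
      have sub: "\<C> \<subseteq> ?X" using chain by (simp add: subset.chain_def)
      have "subset.chain UNIV \<C>" using chain by (simp add: subset.chain_def)
      then have "\<not> derives (\<Union>\<C>) Bot"
        using derives_chain_Union False sub by (force simp: consistent_def)
      then have "\<Union>\<C> \<in> ?X" using sub False by (auto simp: consistent_def)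
      then show ?thesis by blast
    qed
  qed
  then obtain \<Delta> where \<Delta>: "consistent \<Delta>" "\<Gamma> \<subseteq> \<Delta>"
    and max: "\<And>\<Theta>. consistent \<Theta> \<Longrightarrow> \<Delta> \<subseteq> \<Theta> \<Longrightarrow> \<Theta> = \<Delta>"
    by (smt (verit) mem_Collect_eq subset_trans)
  have refuted: "derives \<Delta> (A \<^bold>\<rightarrow> Bot)" if "A \<notin> \<Delta>" "terms_ok js A" for A
  proof (rule deduction)
    have "\<not> consistent (insert A \<Delta>)" using max[of "insert A \<Delta>"] that by blast
    then show "derives (insert A \<Delta>) Bot"
      using \<Delta>(1) that by (auto simp: consistent_def mj_lang_def)
  qed (rule that)
  have "A \<in> \<Delta> \<or> (\<^bold>\<not> A) \<in> \<Delta>" if "terms_ok js A" for A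
  proof (rule ccontr)
    assume "\<not> ?thesis"
    then have "derives \<Delta> (A \<^bold>\<rightarrow> Bot)" "derives \<Delta> (\<^bold>\<not> A \<^bold>\<rightarrow> Bot)"
      using refuted that by auto
    then have "derives \<Delta> Bot"
      by (intro derives_taut_conseq[of "[A \<^bold>\<rightarrow> Bot, \<^bold>\<not> A \<^bold>\<rightarrow> Bot]"]) auto
    then show False using \<Delta> by (simp add: consistent_def)
  qed
  then show ?thesis using \<Delta> that by (auto simp: mcs_def)
qed

lemma mcs_terms_ok: "mcs \<Gamma> \<Longrightarrow> A \<in> \<Gamma> \<Longrightarrow> terms_ok js A"
  by (auto simp: mcs_def consistent_def mj_lang_def)

lemma mcs_derives:
  assumes "mcs \<Gamma>" "derives \<Gamma> A"
  shows "A \<in> \<Gamma>"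
proof (rule ccontr)
  assume "A \<notin> \<Gamma>"
  then have "(\<^bold>\<not> A) \<in> \<Gamma>" using assms derives_terms_ok by (auto simp: mcs_def)
  then have "derives \<Gamma> (\<^bold>\<not> A)" using assms mcs_terms_ok hyp by blast
  then have "derives \<Gamma> Bot"
    using assms(2) by (intro derives_taut_conseq[of "[A, \<^bold>\<not> A]"]) auto
  then show False using assms(1) by (simp add: mcs_def consistent_def)
qed

lemma mcs_provable: "mcs \<Gamma> \<Longrightarrow> provable A \<Longrightarrow> A \<in> \<Gamma>"
  using mcs_derives provable by blast

lemma mcs_mp: "mcs \<Gamma> \<Longrightarrow> A \<in> \<Gamma> \<Longrightarrow> provable (A \<^bold>\<rightarrow> B) \<Longrightarrow> B \<in> \<Gamma>"
  using mcs_derives provable hyp mp mcs_terms_ok by metis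

lemma mcs_taut_conseq:
  assumes "mcs \<Gamma>" "\<forall>e. (\<forall>P\<in>set Ps. bool_eval e P) \<longrightarrow> bool_eval e C"
    and "set Ps \<subseteq> \<Gamma>" "terms_ok js C"
  shows "C \<in> \<Gamma>"
proof (rule mcs_derives[OF assms(1)], rule derives_taut_conseq[OF assms(2)])
  show "\<forall>P\<in>set Ps. derives \<Gamma> P"
    using assms(3) hyp mcs_terms_ok[OF assms(1)] by blast
qed (rule assms(4))

lemma mcs_Bot: "mcs \<Gamma> \<Longrightarrow> Bot \<notin> \<Gamma>"
  using hyp by (fastforce simp: mcs_def consistent_def)

lemma mcs_Neg:
  assumes "mcs \<Gamma>" "terms_ok js A"
  shows "(\<^bold>\<not> A) \<in> \<Gamma> \<longleftrightarrow> A \<notin> \<Gamma>"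
proof -
  have "Bot \<in> \<Gamma>" if "A \<in> \<Gamma>" "(\<^bold>\<not> A) \<in> \<Gamma>"
    using that by (intro mcs_taut_conseq[OF assms(1), of "[A, \<^bold>\<not> A]"]) auto
  then show ?thesis using assms mcs_Bot by (auto simp: mcs_def)
qed

lemma mcs_Imp:
  assumes "mcs \<Gamma>" "terms_ok js A" "terms_ok js B"
  shows "(A \<^bold>\<rightarrow> B) \<in> \<Gamma> \<longleftrightarrow> (A \<in> \<Gamma> \<longrightarrow> B \<in> \<Gamma>)"
proof -
  have "B \<in> \<Gamma>" if "(A \<^bold>\<rightarrow> B) \<in> \<Gamma>" "A \<in> \<Gamma>"
    using that assms by (intro mcs_taut_conseq[OF assms(1), of "[A \<^bold>\<rightarrow> B, A]"]) auto
  moreover have "(A \<^bold>\<rightarrow> B) \<in> \<Gamma>" if "B \<in> \<Gamma>"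
    using that assms by (intro mcs_taut_conseq[OF assms(1), of "[B]"]) auto
  moreover have "(A \<^bold>\<rightarrow> B) \<in> \<Gamma>" if "(\<^bold>\<not> A) \<in> \<Gamma>"
    using that assms by (intro mcs_taut_conseq[OF assms(1), of "[\<^bold>\<not> A]"]) auto
  ultimately show ?thesis using mcs_Neg assms by blast
qed

lemma mcs_And:
  assumes "mcs \<Gamma>" "terms_ok js A" "terms_ok js B"
  shows "(A \<^bold>\<and> B) \<in> \<Gamma> \<longleftrightarrow> A \<in> \<Gamma> \<and> B \<in> \<Gamma>"
proof -
  have "A \<in> \<Gamma>" if "(A \<^bold>\<and> B) \<in> \<Gamma>"
    using that assms by (intro mcs_taut_conseq[OF assms(1), of "[A \<^bold>\<and> B]"]) auto
  moreover have "B \<in> \<Gamma>" if "(A \<^bold>\<and> B) \<in> \<Gamma>"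
    using that assms by (intro mcs_taut_conseq[OF assms(1), of "[A \<^bold>\<and> B]"]) auto
  moreover have "(A \<^bold>\<and> B) \<in> \<Gamma>" if "A \<in> \<Gamma>" "B \<in> \<Gamma>"
    using that assms by (intro mcs_taut_conseq[OF assms(1), of "[A, B]"]) auto
  ultimately show ?thesis by blast
qed

lemma mcs_Or:
  assumes "mcs \<Gamma>" "terms_ok js A" "terms_ok js B"
  shows "(A \<^bold>\<or> B) \<in> \<Gamma> \<longleftrightarrow> A \<in> \<Gamma> \<or> B \<in> \<Gamma>"
proof -
  have "(A \<^bold>\<or> B) \<in> \<Gamma>" if "A \<in> \<Gamma>"
    using that assms by (intro mcs_taut_conseq[OF assms(1), of "[A]"]) auto
  moreover have "(A \<^bold>\<or> B) \<in> \<Gamma>" if "B \<in> \<Gamma>"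
    using that assms by (intro mcs_taut_conseq[OF assms(1), of "[B]"]) auto
  moreover have "B \<in> \<Gamma>" if "(A \<^bold>\<or> B) \<in> \<Gamma>" "(\<^bold>\<not> A) \<in> \<Gamma>"
    using that assms by (intro mcs_taut_conseq[OF assms(1), of "[A \<^bold>\<or> B, \<^bold>\<not> A]"]) auto
  ultimately show ?thesis using mcs_Neg assms by blast
qed


section \<open>The canonical model\<close>

definition canonical_acc :: "(('v, 'c, 'p) fml set \<times> ('v, 'c, 'p) fml set) set" where
  "canonical_acc = {(\<Gamma>, \<Delta>). mcs \<Gamma> \<and> mcs \<Delta> \<and> (\<forall>A. (\<^bold>\<box> A) \<in> \<Gamma> \<longrightarrow> A \<in> \<Delta>)}"

definition canonical_model :: "(('v, 'c, 'p) fml set, 'v, 'c, 'p) mj_model" where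
  "canonical_model = \<lparr>worlds = {\<Gamma>. mcs \<Gamma>}, acc = canonical_acc,
    evid = \<lambda>t A. {\<Gamma>. mcs \<Gamma> \<and> (t \<^bold>: A) \<in> \<Gamma>}, val = \<lambda>p. {\<Gamma>. mcs \<Gamma> \<and> Prop p \<in> \<Gamma>}\<rparr>"

lemma canonical_acc_unbox: "(\<Gamma>, \<Delta>) \<in> canonical_acc \<Longrightarrow> (\<^bold>\<box> A) \<in> \<Gamma> \<Longrightarrow> A \<in> \<Delta>"
  by (simp add: canonical_acc_def)

text \<open>
  If the unboxed formulas of a world derive \<open>A\<close>, then by \<open>K\<close> and Necessitation the world
  contains \<open>\<box> A\<close>. Otherwise they are consistent with \<open>\<not> A\<close>.
\<close>

lemma canonical_acc_witness:
  assumes "mcs \<Gamma>" "terms_ok js A" "(\<^bold>\<box> A) \<notin> \<Gamma>"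
  obtains \<Delta> where "(\<Gamma>, \<Delta>) \<in> canonical_acc" "A \<notin> \<Delta>"
proof -
  let ?U = "{B. (\<^bold>\<box> B) \<in> \<Gamma>}"
  have "consistent (insert (\<^bold>\<not> A) ?U)"
    unfolding consistent_def
  proof
    show "insert (\<^bold>\<not> A) ?U \<subseteq> mj_lang js"
      using assms mcs_terms_ok by (fastforce simp: mj_lang_def)
    show "\<not> derives (insert (\<^bold>\<not> A) ?U) Bot"
    proof
      assume "derives (insert (\<^bold>\<not> A) ?U) Bot"
      then have "derives ?U (\<^bold>\<not> A \<^bold>\<rightarrow> Bot)"
        using assms(2) by (intro deduction) auto
      then have "derives ?U A"
        using assms(2) by (intro derives_taut_conseq[of "[\<^bold>\<not> A \<^bold>\<rightarrow> Bot]"]) auto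
      then have "derives \<Gamma> (\<^bold>\<box> A)"
        using derives_mono[OF derives_Box] by blast
      then show False using assms mcs_derives by blast
    qed
  qed
  then obtain \<Delta> where \<Delta>: "mcs \<Delta>" "insert (\<^bold>\<not> A) ?U \<subseteq> \<Delta>"
    using lindenbaum by blast
  then have "(\<Gamma>, \<Delta>) \<in> canonical_acc" "A \<notin> \<Delta>"
    using assms mcs_Neg by (auto simp: canonical_acc_def)
  then show ?thesis using that by blast
qed

lemma mcs_Box:
  assumes "mcs \<Gamma>" "terms_ok js A"
  shows "(\<^bold>\<box> A) \<in> \<Gamma> \<longleftrightarrow> (\<forall>\<Delta>. (\<Gamma>, \<Delta>) \<in> canonical_acc \<longrightarrow> A \<in> \<Delta>)"
  using canonical_acc_witness[OF assms] canonical_acc_unbox by metis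

lemma truth_lemma:
  "mcs \<Gamma> \<Longrightarrow> terms_ok js A \<Longrightarrow> forces canonical_model \<Gamma> A \<longleftrightarrow> A \<in> \<Gamma>"
proof (induction A arbitrary: \<Gamma>)
  case (Prop p)
  then show ?case by (simp add: canonical_model_def)
next
  case Bot
  then show ?case by (simp add: mcs_Bot)
next
  case (Neg A)
  then show ?case by (simp add: mcs_Neg)
next
  case (And A B)
  then show ?case by (simp add: mcs_And)
next
  case (Or A B)
  then show ?case by (simp add: mcs_Or)
next
  case (Imp A B)
  then show ?case by (simp add: mcs_Imp)
next
  case (Box A)
  then have "forces canonical_model \<Delta> A \<longleftrightarrow> A \<in> \<Delta>" if "(\<Gamma>, \<Delta>) \<in> canonical_acc" for \<Delta>
    using that by (simp add: canonical_acc_def)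
  then show ?case
    using Box.prems by (simp add: mcs_Box canonical_model_def)
next
  case (Just t A)
  have "provable (t \<^bold>: A \<^bold>\<rightarrow> \<^bold>\<box> A)"
    using Just.prems by (intro provable_axiom disjI2 connection_inst.intros) auto
  then have "forces canonical_model \<Delta> A" if "(t \<^bold>: A) \<in> \<Gamma>" "(\<Gamma>, \<Delta>) \<in> canonical_acc" for \<Delta>
    using that Just mcs_mp[of \<Gamma>] by (auto simp: canonical_acc_def)
  then show ?case
    using Just.prems by (auto simp: canonical_model_def)
qed

text \<open>
  Transitivity, symmetry and the other properties are read off from the definition of
  accessibility, except seriality: (D) keeps \<open>\<box> \<bottom>\<close> out of every world, so every world has
  an accessible world omitting \<open>\<bottom>\<close>.
\<close>

lemma canonical_frame_cond:
  assumes "\<And>A. terms_ok js A \<Longrightarrow> provable (modal_scheme m A)"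
  shows "frame_cond m {\<Gamma>. mcs \<Gamma>} canonical_acc"
proof (cases m)
  case mT
  have "A \<in> \<Gamma>" if "mcs \<Gamma>" "(\<^bold>\<box> A) \<in> \<Gamma>" for \<Gamma> A
    using mcs_mp[OF that] assms[of A] mT mcs_terms_ok[OF that] by simp
  then show ?thesis using mT by (auto simp: canonical_acc_def)
next
  case mD
  have "(\<^bold>\<box> Bot) \<notin> \<Gamma>" if "mcs \<Gamma>" for \<Gamma>
    using mcs_mp[OF that] assms[of Bot] mD mcs_Bot[OF that] by auto
  then have "\<exists>\<Delta>. (\<Gamma>, \<Delta>) \<in> canonical_acc" if "mcs \<Gamma>" for \<Gamma>
    using canonical_acc_witness[of \<Gamma> Bot] that by auto
  then show ?thesis using mD by auto
next
  case m4
  have box2: "(\<^bold>\<box> \<^bold>\<box> A) \<in> \<Gamma>" if "mcs \<Gamma>" "(\<^bold>\<box> A) \<in> \<Gamma>" for \<Gamma> A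
    using mcs_mp[OF that] assms[of A] m4 mcs_terms_ok[OF that] by simp
  have "trans canonical_acc"
    unfolding trans_def by (auto simp: canonical_acc_def dest: box2)
  then show ?thesis using m4 by simp
next
  case mB
  have "(\<Delta>, \<Gamma>) \<in> canonical_acc" if R: "(\<Gamma>, \<Delta>) \<in> canonical_acc" for \<Gamma> \<Delta>
  proof -
    have mcs: "mcs \<Gamma>" "mcs \<Delta>" using R by (auto simp: canonical_acc_def)
    have "A \<in> \<Gamma>" if A: "(\<^bold>\<box> A) \<in> \<Delta>" for A
    proof (rule ccontr)
      have ok: "terms_ok js A" using mcs_terms_ok[OF mcs(2) A] by simp
      assume "A \<notin> \<Gamma>"
      then have "(\<^bold>\<not> A) \<in> \<Gamma>" using mcs_Neg mcs(1) ok by simp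
      then have "(\<^bold>\<box> \<^bold>\<not> \<^bold>\<box> A) \<in> \<Gamma>" using mcs_mp[OF mcs(1)] assms[OF ok] mB by simp
      then have "(\<^bold>\<not> \<^bold>\<box> A) \<in> \<Delta>" using canonical_acc_unbox R by blast
      then show False using mcs_Neg[OF mcs(2), of "\<^bold>\<box> A"] A ok by simp
    qed
    then show ?thesis using mcs by (simp add: canonical_acc_def)
  qed
  then show ?thesis using mB by (auto intro: symI)
next
  case m5
  have "(\<Delta>, \<Theta>) \<in> canonical_acc"
    if R: "(\<Gamma>, \<Delta>) \<in> canonical_acc" "(\<Gamma>, \<Theta>) \<in> canonical_acc" for \<Gamma> \<Delta> \<Theta>
  proof -
    have mcs: "mcs \<Gamma>" "mcs \<Delta>" "mcs \<Theta>" using R by (auto simp: canonical_acc_def)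
    have "A \<in> \<Theta>" if A: "(\<^bold>\<box> A) \<in> \<Delta>" for A
    proof (rule ccontr)
      have ok: "terms_ok js A" using mcs_terms_ok[OF mcs(2) A] by simp
      assume "A \<notin> \<Theta>"
      then have "(\<^bold>\<box> A) \<notin> \<Gamma>" using canonical_acc_unbox R by blast
      then have "(\<^bold>\<not> \<^bold>\<box> A) \<in> \<Gamma>" using mcs_Neg[OF mcs(1), of "\<^bold>\<box> A"] ok by simp
      then have "(\<^bold>\<box> \<^bold>\<not> \<^bold>\<box> A) \<in> \<Gamma>" using mcs_mp[OF mcs(1)] assms[OF ok] m5 by simp
      then have "(\<^bold>\<not> \<^bold>\<box> A) \<in> \<Delta>" using canonical_acc_unbox R by blast
      then show False using mcs_Neg[OF mcs(2), of "\<^bold>\<box> A"] A ok by simp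
    qed
    then show ?thesis using mcs by (simp add: canonical_acc_def)
  qed
  then show ?thesis unfolding m5 frame_cond.simps by blast
qed

lemma modal_thm_subst_provable:
  assumes "modal_thm ms A" "\<And>p. terms_ok js (\<sigma> p)"
  shows "provable (subst \<sigma> A)"
  using assms(1)
proof (induction rule: modal_thm.induct)
  case (modal_ax A)
  then have A: "modal_inst ms A" "terms_ok js (subst \<sigma> A)"
    using assms(2) by (auto simp: modal_axioms_def modal_lang_def terms_ok_subst)
  from A(1) have "modal_inst ms (subst \<sigma> A)"
    by (cases rule: modal_instE)
      (auto simp: subst_modal_scheme intro: m_taut tautology_subst m_K modal_inst_scheme)
  then show ?case using A by (simp add: provable_axiom)
next
  case (modal_mp A B)
  then show ?case using mj_mp by auto
next
  case (modal_nec A)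
  then show ?case using mj_nec by auto
qed

lemma provable_counterpart:
  assumes "mj_logic TYPE(('v, 'c, 'p) fml) ms js" "x \<in> js" "terms_ok js A"
  shows "provable (modal_scheme (counterpart x) A)"
  using modal_thm_subst_provable[OF mj_logic_counterpart_provable[OF assms(1,2)], of "\<lambda>_. A"] assms(3)
  by (simp add: subst_modal_scheme)

lemma canonical_frame_cond_just:
  assumes "mj_logic TYPE(('v, 'c, 'p) fml) ms js" "x \<in> js"
  shows "frame_cond (counterpart x) {\<Gamma>. mcs \<Gamma>} canonical_acc"
  using canonical_frame_cond provable_counterpart[OF assms] by blast

lemma canonical_frame_cond_modal:
  assumes "m \<in> ms"
  shows "frame_cond m {\<Gamma>. mcs \<Gamma>} canonical_acc"
proof (rule canonical_frame_cond)
  fix A :: "('v, 'c, 'p) fml" assume "terms_ok js A"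
  then have "terms_ok js (modal_scheme m A)" by (cases m) auto
  then show "provable (modal_scheme m A)"
    using assms by (simp add: provable_axiom modal_inst_scheme)
qed

lemma mcs_just_inst_mp:
  assumes "just_inst js (A \<^bold>\<rightarrow> B)" "mcs \<Gamma>" "A \<in> \<Gamma>" "terms_ok js B"
  shows "B \<in> \<Gamma>"
  using assms mcs_terms_ok by (intro mcs_mp[of \<Gamma> A B] provable_axiom) auto

lemma canonical_model_is_mj_model:
  assumes logic: "mj_logic TYPE(('v, 'c, 'p) fml) ms js" and "mcs \<Gamma>\<^sub>0"
  shows "is_mj_model ms js CS canonical_model"
proof -
  let ?W = "{\<Gamma>. mcs \<Gamma>}" and ?E = "\<lambda>t A. {\<Gamma>. mcs \<Gamma> \<and> (t \<^bold>: A) \<in> \<Gamma>}"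
  have sel: "worlds canonical_model = ?W" "acc canonical_model = canonical_acc"
    "evid canonical_model = ?E" "val canonical_model p \<subseteq> ?W" for p
    by (auto simp: canonical_model_def)
  have acc: "canonical_acc \<subseteq> ?W \<times> ?W"
    by (auto simp: canonical_acc_def)
  note frame = canonical_frame_cond_just[OF logic]
  have CS_evid: "?E (JConst c) F = ?W" if "(JConst c) \<^bold>: F \<in> CS" for c F
    using that mcs_provable mj_const by blast
  have app: "?E s (A \<^bold>\<rightarrow> B) \<inter> ?E t A \<subseteq> ?E (App s t) B"
    if "term_of js s" "term_of js t" "A \<in> mj_lang js" "B \<in> mj_lang js" for s t A B
  proof -
    have "(App s t \<^bold>: B) \<in> \<Gamma>" if \<Gamma>: "mcs \<Gamma>" "(s \<^bold>: (A \<^bold>\<rightarrow> B)) \<in> \<Gamma>" "(t \<^bold>: A) \<in> \<Gamma>" for \<Gamma>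
    proof -
      have "(t \<^bold>: A \<^bold>\<rightarrow> App s t \<^bold>: B) \<in> \<Gamma>"
        using mcs_just_inst_mp[OF j_app \<Gamma>(1,2)] \<open>term_of js s\<close> \<open>term_of js t\<close>
          \<open>A \<in> mj_lang js\<close> \<open>B \<in> mj_lang js\<close> by (simp add: mj_lang_def)
      then show ?thesis
        using mcs_Imp[OF \<Gamma>(1)] \<Gamma>(3) \<open>term_of js s\<close> \<open>term_of js t\<close>
          \<open>A \<in> mj_lang js\<close> \<open>B \<in> mj_lang js\<close> by (simp add: mj_lang_def)
    qed
    then show ?thesis by blast
  qed
  have plus: "?E s A \<union> ?E t A \<subseteq> ?E (Plus s t) A"
    if "term_of js s" "term_of js t" "A \<in> mj_lang js" for s t A
    using that mcs_just_inst_mp[OF j_sum1[of js s A t]] mcs_just_inst_mp[OF j_sum2[of js t A s]]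
    by (auto simp: mj_lang_def)
  have bang: "?E t A \<subseteq> ?E (Bang t) (t \<^bold>: A)"
    if "j4 \<in> js" "term_of js t" "A \<in> mj_lang js" for t A
    using that mcs_just_inst_mp[OF j_4] by (auto simp: mj_lang_def)
  \<comment> \<open>Evidence persists because \<open>t : A\<close> yields \<open>!t : t : A\<close>, which the connection axiom turns into
    \<open>\<box> t : A\<close>.\<close>
  have persist: "\<Delta> \<in> ?E t A"
    if "j4 \<in> js" "term_of js t" "A \<in> mj_lang js" "\<Gamma> \<in> ?E t A" "(\<Gamma>, \<Delta>) \<in> canonical_acc" for t A \<Gamma> \<Delta>
  proof -
    have "\<Gamma> \<in> ?E (Bang t) (t \<^bold>: A)" using bang[OF that(1-3)] that(4) by blast
    moreover have "provable (Bang t \<^bold>: t \<^bold>: A \<^bold>\<rightarrow> \<^bold>\<box> t \<^bold>: A)"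
      using that by (intro provable_axiom disjI2 connection_inst.intros) (auto simp: mj_lang_def)
    ultimately have "(\<^bold>\<box> t \<^bold>: A) \<in> \<Gamma>" using mcs_mp by blast
    then show ?thesis using that(5) by (simp add: canonical_acc_def)
  qed
  have bquery: "\<Gamma> \<in> ?E (BQuery t) (\<^bold>\<not> t \<^bold>: A)"
    if "jB \<in> js" "term_of js t" "A \<in> mj_lang js" "mcs \<Gamma>" "forces canonical_model \<Gamma> (\<^bold>\<not> A)" for t A \<Gamma>
  proof -
    have "(\<^bold>\<not> A) \<in> \<Gamma>"
      using truth_lemma[of \<Gamma> "\<^bold>\<not> A"] that by (simp add: mj_lang_def del: forces.simps)
    then show ?thesis
      using that mcs_just_inst_mp[OF j_B[of js A t]] by (auto simp: mj_lang_def)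
  qed
  have query: "?W - ?E t A \<subseteq> ?E (Query t) (\<^bold>\<not> t \<^bold>: A)"
    if "j5 \<in> js" "term_of js t" "A \<in> mj_lang js" for t A
  proof -
    have "(Query t \<^bold>: \<^bold>\<not> t \<^bold>: A) \<in> \<Gamma>" if \<Gamma>: "mcs \<Gamma>" "(t \<^bold>: A) \<notin> \<Gamma>" for \<Gamma>
    proof -
      have "(\<^bold>\<not> t \<^bold>: A) \<in> \<Gamma>"
        using mcs_Neg[OF \<Gamma>(1), of "t \<^bold>: A"] \<Gamma>(2) \<open>term_of js t\<close> \<open>A \<in> mj_lang js\<close>
        by (simp add: mj_lang_def)
      then show ?thesis
        using mcs_just_inst_mp[OF j_5] \<Gamma>(1) \<open>j5 \<in> js\<close> \<open>term_of js t\<close> \<open>A \<in> mj_lang js\<close>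
        by (simp add: mj_lang_def)
    qed
    then show ?thesis by auto
  qed
  have strong: "forces canonical_model \<Gamma> (t \<^bold>: A)"
    if "term_of js t" "A \<in> mj_lang js" "\<Gamma> \<in> ?E t A" for t A \<Gamma>
    using truth_lemma[of \<Gamma> "t \<^bold>: A"] that by (simp add: mj_lang_def del: forces.simps)
  have euclid: "m5 \<in> ms \<Longrightarrow> \<forall>u v w. (u, v) \<in> canonical_acc \<longrightarrow> (u, w) \<in> canonical_acc \<longrightarrow> (v, w) \<in> canonical_acc"
    by (rule canonical_frame_cond_modal[of m5, unfolded frame_cond.simps])
  have refl: "jT \<in> js \<Longrightarrow> refl_on ?W canonical_acc"
    using frame[of jT] acc by (auto simp: refl_on_def)
  have serial: "jD \<in> js \<Longrightarrow> \<forall>w\<in>?W. \<exists>v. (w, v) \<in> canonical_acc"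
    using frame[of jD] by simp
  have trans: "j4 \<in> js \<Longrightarrow> trans canonical_acc" and sym: "jB \<in> js \<Longrightarrow> sym canonical_acc"
    using frame[of j4] frame[of jB] by simp_all
  show ?thesis
    unfolding is_mj_model_def sel
    apply (intro conjI)
    subgoal using assms(2) by blast
    subgoal by (rule acc)
    subgoal using sel by blast
    subgoal by blast
    subgoal using CS_evid by blast
    subgoal using app by blast
    subgoal using plus by blast
    subgoal using refl by blast
    subgoal using serial by blast
    subgoal using trans persist bang by blast
    subgoal using sym bquery by blast
    subgoal using query strong by blast
    subgoal using euclid by blast
    done
qed

lemma completeness:
  assumes logic: "mj_logic TYPE(('v, 'c, 'p) fml) ms js" and F: "terms_ok js F"
    and valid: "\<And>M :: (('v, 'c, 'p) fml set, 'v, 'c, 'p) mj_model. is_mj_model ms js CS M \<Longrightarrow> true_in M F"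
  shows "provable F"
proof (rule ccontr)
  assume "\<not> provable F"
  have "\<not> derives {\<^bold>\<not> F} Bot"
  proof
    assume "derives {\<^bold>\<not> F} Bot"
    then have "derives {} (\<^bold>\<not> F \<^bold>\<rightarrow> Bot)" using F by (intro deduction) auto
    then have "derives {} F"
      using F by (intro derives_taut_conseq[of "[\<^bold>\<not> F \<^bold>\<rightarrow> Bot]"]) auto
    then show False using derives_empty \<open>\<not> provable F\<close> by blast
  qed
  then have "consistent {\<^bold>\<not> F}" using F by (simp add: consistent_def mj_lang_def)
  then obtain \<Gamma> where \<Gamma>: "mcs \<Gamma>" "{\<^bold>\<not> F} \<subseteq> \<Gamma>" using lindenbaum by blast
  then have "true_in canonical_model F"
    using valid canonical_model_is_mj_model[OF logic] by blast
  then have "forces canonical_model \<Gamma> F"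
    using \<Gamma> by (simp add: true_in_def canonical_model_def)
  then show False using truth_lemma mcs_Neg \<Gamma> F by auto
qed

end


section \<open>Soundness and completeness\<close>

theorem theorem10p8:
  fixes ms :: "mscheme set" and js :: "jscheme set"
    and CS :: "('v, 'c, 'p) fml set" and F :: "('v, 'c, 'p) fml"
  assumes "mj_logic TYPE(('v, 'c, 'p) fml) ms js"
    and "constant_spec ms js CS"
    and "jD \<in> js \<Longrightarrow> axiomatically_appropriate ms js CS"
    and "F \<in> mj_lang js"
  shows "(mj_thm ms js CS F \<longleftrightarrow>
      (\<forall>M :: (('v, 'c, 'p) fml set, 'v, 'c, 'p) mj_model. is_mj_model ms js CS M \<longrightarrow> true_in M F))
    \<and> (mj_thm ms js CS F \<longrightarrow>
      (\<forall>M :: ('w, 'v, 'c, 'p) mj_model. is_mj_model ms js CS M \<longrightarrow> true_in M F))"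
proof -
  interpret mj_calculus ms js CS
    by unfold_locales (rule assms(2))
  have "terms_ok js F" using assms(4) by (simp add: mj_lang_def)
  note complete = completeness[OF assms(1) this]
  have sound: "true_in M F" if "mj_thm ms js CS F" "is_mj_model ms js CS M"
    for M :: "(('v, 'c, 'p) fml set, 'v, 'c, 'p) mj_model"
    using mj_thm_sound[OF assms(1,2) that(2,1)] by (simp add: true_in_def)
  have sound': "true_in M F" if "mj_thm ms js CS F" "is_mj_model ms js CS M"
    for M :: "('w, 'v, 'c, 'p) mj_model"
    using mj_thm_sound[OF assms(1,2) that(2,1)] by (simp add: true_in_def)
  show ?thesis
    using complete sound sound' by blast
qed

end
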